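(* Let $0<q<1$, let $r,s,t\in\mathbb{Z}_{\ge0}$, and let $\alpha_1,\alpha_2,\beta_1,\beta_2,\gamma_1,\gamma_2,\gamma_3,\lambda_1,\lambda_2,\mu_1,\mu_2,\mu_3,\delta_1,\delta_2,\delta_3\in\mathbb{C}$ be such that no denominator occurring below vanishes. Then \begin{align*} &\phi^{(3)}\left[\begin{matrix}-::-;q^{\alpha_2};q^{\beta_1}:q^{\alpha_1},q^{-r};q^{\beta_2},q^{-s};q^{-t}\\ -::-;-;-:q^{\gamma_1},\delta_1;q^{\gamma_2},\delta_2;q^{\gamma_3},\delta_3\end{matrix};q,q,q,q\right]\\ &=\sum_{i=0}^r\sum_{j=0}^s\sum_{k=0}^t w_1(i,r;q)\,w_2(j,s;q)\,w_3(k,t;q)\; \phi^{(3)}\left[\begin{matrix}-::-;q^{\alpha_2};q^{\beta_1}:q^{\lambda_1},q^{-i};q^{\lambda_2},q^{-j};q^{-k}\\ -::-;-;-:q^{\mu_1},\delta_1;q^{\mu_2},\delta_2;q^{\mu_3},\delta_3\end{matrix};q,q,q,q\right], \end{align*} where \begin{align*} w_1(i,r;q)&:=\frac{(q^{\alpha_1},q;q)_r}{(q^{\gamma_1},q^{\lambda_1};q)_r}\frac{(q^{\gamma_1+\lambda_1-\alpha_1-\mu_1};q)_{r-i}}{(q;q)_{r-i}}\frac{(q^{\mu_1};q)_i}{(q;q)_i}\,{}_3\phi_2\left[\begin{matrix}q^{\lambda_1-\alpha_1},q^{\gamma_1-\alpha_1},q^{i-r}\\ q^{\gamma_1+\lambda_1-\alpha_1-\mu_1},q^{1-r-\alpha_1}\end{matrix};q,q^{1-i-\mu_1}\right]q^{(r-i)\mu_1},\\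 w_2(j,s;q)&:=\frac{(q^{\beta_2},q;q)_s}{(q^{\gamma_2},q^{\lambda_2};q)_s}\frac{(q^{\gamma_2+\lambda_2-\beta_2-\mu_2};q)_{s-j}}{(q;q)_{s-j}}\frac{(q^{\mu_2};q)_j}{(q;q)_j}\,{}_3\phi_2\left[\begin{matrix}q^{\lambda_2-\beta_2},q^{\gamma_2-\beta_2},q^{j-s}\\ q^{\gamma_2+\lambda_2-\beta_2-\mu_2},q^{1-s-\beta_2}\end{matrix};q,q^{1-j-\mu_2}\right]q^{(s-j)\mu_2},\\ w_3(k,t;q)&:=\frac{(q;q)_t}{(q^{\gamma_3};q)_t}\frac{(q^{\gamma_3-\mu_3};q)_{t-k}}{(q;q)_{t-k}}\frac{(q^{\mu_3};q)_k}{(q;q)_k}q^{(t-k)\mu_3}. \end{align*}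
   Context: $(a;q)_n=\prod_{j=0}^{n-1}(1-aq^j)$, $(a_1,\dots,a_m;q)_n=(a_1;q)_n\cdots(a_m;q)_n$, and ${}_{3}\phi_{2}\left[\begin{matrix}a_1,a_2,a_3\\ b_1,b_2\end{matrix};q,z\right]=\sum_{n\ge0}\frac{(a_1,a_2,a_3;q)_n}{(b_1,b_2,q;q)_n}z^n$ (all ${}_3\phi_2$ here terminate). The function $\phi^{(3)}$ is the general triple basic hypergeometric series; in the case used here it is \[ \phi^{(3)}\left[\begin{matrix}-::-;b';b'':c_1,c_2;c_1',c_2';c''\\ -::-;-;-:h_1,h_2;h_1',h_2';h_1'',h_2''\end{matrix};q,x,y,z\right]=\sum_{m,n,p=0}^{\infty}(b';q)_{n+p}(b'';q)_{p+m}\frac{(c_1,c_2;q)_m}{(h_1,h_2;q)_m}\frac{(c_1',c_2';q)_n}{(h_1',h_2';q)_n}\frac{(c'';q)_p}{(h_1'',h_2'';q)_p}\frac{x^m}{(q;q)_m}\frac{y^n}{(q;q)_n}\frac{z^p}{(q;q)_p}, \] and each $\phi^{(3)}$ in the claim is a finite sum because of the parameters $q^{-r},q^{-s},q^{-t}$ (resp. $q^{-i},q^{-j},q^{-k}$). *)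

theory Defs
  imports "HOL-Analysis.Analysis"
begin

text \<open>The base \<open>q\<close> is a real number in the open unit interval, so \<open>q\<^sup>a\<close> for complex \<open>a\<close> is
  \<open>exp (a * ln q)\<close> with the real logarithm; this is what \<^const>\<open>powr\<close> yields.\<close>

abbreviation qpow :: "real \<Rightarrow> complex \<Rightarrow> complex" where
  "qpow q a \<equiv> complex_of_real q powr a"

definition qpoch :: "complex \<Rightarrow> real \<Rightarrow> nat \<Rightarrow> complex" where
  "qpoch a q n = (\<Prod>j<n. 1 - a * complex_of_real q ^ j)"

definition qpochs :: "complex list \<Rightarrow> real \<Rightarrow> nat \<Rightarrow> complex" where
  "qpochs as q n = (\<Prod>a\<leftarrow>as. qpoch a q n)"

text \<open>In the two series below, a numerator parameter \<open>q\<^sup>-\<^sup>N\<close> makes all terms beyond \<open>N\<close> equal to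
  zero, also when a denominator factor happens to vanish there, since \<open>0 / 0 = 0\<close>.\<close>

definition phi32 ::
  "complex \<Rightarrow> complex \<Rightarrow> complex \<Rightarrow> complex \<Rightarrow> complex \<Rightarrow> real \<Rightarrow> complex \<Rightarrow> complex" where
  "phi32 a1 a2 a3 b1 b2 q z =
     (\<Sum>n. qpochs [a1, a2, a3] q n / qpochs [b1, b2, complex_of_real q] q n * z ^ n)"

text \<open>The triple series with the parameter rows that are empty throughout left out: the
  arguments are \<open>b'; b'' : c; c'; c''\<close> (numerator), \<open>h; h'; h''\<close> (denominator), \<open>q, x, y, z\<close>.\<close>

definition phi3 ::
  "complex list \<Rightarrow> complex list \<Rightarrow> complex list \<Rightarrow> complex list \<Rightarrow> complex list \<Rightarrow>
   complex list \<Rightarrow> complex list \<Rightarrow> complex list \<Rightarrow>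
   real \<Rightarrow> complex \<Rightarrow> complex \<Rightarrow> complex \<Rightarrow> complex" where
  "phi3 b' b'' c c' c'' h h' h'' q x y z =
     (\<Sum>\<^sub>\<infinity>(m, n, p)\<in>(UNIV :: (nat \<times> nat \<times> nat) set).
        qpochs b' q (n + p) * qpochs b'' q (p + m)
        * (qpochs c q m / qpochs h q m)
        * (qpochs c' q n / qpochs h' q n)
        * (qpochs c'' q p / qpochs h'' q p)
        * (x ^ m / qpoch (complex_of_real q) q m)
        * (y ^ n / qpoch (complex_of_real q) q n)
        * (z ^ p / qpoch (complex_of_real q) q p))"

text \<open>\<open>w\<^sub>1\<close> and \<open>w\<^sub>2\<close> are the same function of their parameters: \<open>w\<^sub>1(i,r;q)\<close> is
  \<open>w12 \<alpha>\<^sub>1 \<gamma>\<^sub>1 \<lambda>\<^sub>1 \<mu>\<^sub>1 i r q\<close> and \<open>w\<^sub>2(j,s;q)\<close> is \<open>w12 \<beta>\<^sub>2 \<gamma>\<^sub>2 \<lambda>\<^sub>2 \<mu>\<^sub>2 j s q\<close>.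
  Only arguments with \<open>i \<le> r\<close> are meaningful.\<close>

definition w12 ::
  "complex \<Rightarrow> complex \<Rightarrow> complex \<Rightarrow> complex \<Rightarrow> nat \<Rightarrow> nat \<Rightarrow> real \<Rightarrow> complex" where
  "w12 \<alpha> \<gamma> lam \<mu> i r q =
     qpochs [qpow q \<alpha>, complex_of_real q] q r / qpochs [qpow q \<gamma>, qpow q lam] q r
     * (qpoch (qpow q (\<gamma> + lam - \<alpha> - \<mu>)) q (r - i) / qpoch (complex_of_real q) q (r - i))
     * (qpoch (qpow q \<mu>) q i / qpoch (complex_of_real q) q i)
     * phi32 (qpow q (lam - \<alpha>)) (qpow q (\<gamma> - \<alpha>)) (qpow q (of_nat i - of_nat r))
         (qpow q (\<gamma> + lam - \<alpha> - \<mu>)) (qpow q (1 - of_nat r - \<alpha>))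
         q (qpow q (1 - of_nat i - \<mu>))
     * qpow q (of_nat (r - i) * \<mu>)"

definition w3 :: "complex \<Rightarrow> complex \<Rightarrow> nat \<Rightarrow> nat \<Rightarrow> real \<Rightarrow> complex" where
  "w3 \<gamma> \<mu> k t q =
     qpoch (complex_of_real q) q t / qpoch (qpow q \<gamma>) q t
     * (qpoch (qpow q (\<gamma> - \<mu>)) q (t - k) / qpoch (complex_of_real q) q (t - k))
     * (qpoch (qpow q \<mu>) q k / qpoch (complex_of_real q) q k)
     * qpow q (of_nat (t - k) * \<mu>)"

end

theory Submission
  imports Defs
begin

text \<open>The coefficients of the triple series couple the summation indices only through
  \<open>(q\<^bsup>\<alpha>\<^sub>2\<^esup>;q)\<^bsub>n+p\<^esub>\<close> and \<open>(q\<^bsup>\<beta>\<^sub>1\<^esup>;q)\<^bsub>p+m\<^esub>\<close>, which are the same on both sides, so the claim splits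
  into three one-variable connection identities such as
  \<open>\<Sum>\<^sub>i w\<^sub>1(i,r) (q\<^bsup>\<lambda>\<^esup>,q\<^bsup>-i\<^esup>;q)\<^sub>m/(q\<^bsup>\<mu>\<^esup>;q)\<^sub>m = (q\<^bsup>\<alpha>\<^esup>,q\<^bsup>-r\<^esup>;q)\<^sub>m/(q\<^bsup>\<gamma>\<^esup>;q)\<^sub>m\<close>. After inserting the definition
  of \<open>w\<^sub>1\<close> and exchanging sums, these follow from the q-Vandermonde and q-Pfaff-Saalschuetz
  summations.\<close>

section \<open>q-shifted factorials: splitting, termination and reversal\<close>

lemma qpoch_0 [simp]: "qpoch a q 0 = 1"
  by (simp add: qpoch_def)

lemma qpoch_Suc: "qpoch a q (Suc n) = qpoch a q n * (1 - a * complex_of_real q ^ n)"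
  by (simp add: qpoch_def)

lemma qpoch_add:
  "qpoch a q (m + n) = qpoch a q m * qpoch (a * complex_of_real q ^ m) q n"
  by (induction n) (simp_all add: qpoch_Suc power_add mult.assoc)

lemma qpoch_split:
  assumes "m \<le> n"
  shows "qpoch a q n = qpoch a q m * qpoch (a * complex_of_real q ^ m) q (n - m)"
  using qpoch_add[of a q m "n - m"] assms by simp

lemma qpoch_nonzero_le:
  assumes "qpoch a q n \<noteq> 0" "m \<le> n"
  shows "qpoch a q m \<noteq> 0"
  using assms by (auto simp: qpoch_split[of m n])

lemma qpoch_base_nonzero:
  assumes "0 < q" "q < 1"
  shows "qpoch (complex_of_real q) q n \<noteq> 0"
proof -
  have "1 - complex_of_real q * complex_of_real q ^ j \<noteq> 0" for j
  proof -
    have "q ^ Suc j < 1"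
      using assms by (intro power_Suc_less_one) auto
    then have "complex_of_real (q ^ Suc j) \<noteq> 1"
      by (metis less_irrefl of_real_eq_1_iff)
    then show ?thesis by simp
  qed
  then show ?thesis by (simp add: qpoch_def)
qed

lemma qpoch_terminates:
  assumes "y * complex_of_real q ^ k = 1" "k < n"
  shows "qpoch y q n = 0"
  using assms by (auto simp: qpoch_def)

text \<open>Here \<open>x = q\<^bsup>1-N\<^esup>/a\<close>.\<close>
lemma qpoch_reversal:
  assumes "x * a * complex_of_real q ^ N = complex_of_real q" "n \<le> N"
  shows "qpoch x q n * qpoch a q (N - n) * (a * complex_of_real q ^ N) ^ n
       = (\<Prod>j<n. - (complex_of_real q ^ j)) * complex_of_real q ^ n * qpoch a q N"
  using assms(2)
proof (induction n)
  case (Suc n)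
  let ?Q = "complex_of_real q"
  have N: "N - n = Suc (N - Suc n)" using Suc.prems by simp
  have "a * ?Q ^ N = a * ?Q ^ (N - Suc n) * ?Q ^ Suc n"
    using Suc.prems by (metis mult.assoc power_add le_add_diff_inverse2)
  \<comment> \<open>Since \<open>x * a * q^N = q\<close>, the next factor of \<open>(x;q)\<close>
    equals, up to a monomial, the last factor of \<open>(a;q)_(N-n)\<close>; the factors of
    \<open>(a;q)_N\<close> are thus consumed from the top.\<close>
  then have step: "(1 - x * ?Q ^ n) * (a * ?Q ^ N) = - (?Q ^ n) * ?Q * (1 - a * ?Q ^ (N - Suc n))"
  proof -
    assume aN: "a * ?Q ^ N = a * ?Q ^ (N - Suc n) * ?Q ^ Suc n"
    have "(1 - x * ?Q ^ n) * (a * ?Q ^ N) = a * ?Q ^ N - (x * a * ?Q ^ N) * ?Q ^ n"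
      by (simp add: algebra_simps)
    then show ?thesis
      unfolding assms(1) unfolding aN by (simp add: algebra_simps)
  qed
  have IH: "qpoch x q n * qpoch a q (N - n) * (a * ?Q ^ N) ^ n
      = (\<Prod>j<n. - (?Q ^ j)) * ?Q ^ n * qpoch a q N"
    using Suc by simp
  have "qpoch x q (Suc n) * qpoch a q (N - Suc n) * (a * ?Q ^ N) ^ Suc n
      = qpoch x q n * qpoch a q (N - Suc n) * (a * ?Q ^ N) ^ n * ((1 - x * ?Q ^ n) * (a * ?Q ^ N))"
    by (simp only: qpoch_Suc power_Suc mult_ac)
  also have "\<dots> = (qpoch x q n * qpoch a q (N - n) * (a * ?Q ^ N) ^ n) * (- (?Q ^ n) * ?Q)"
    unfolding step N qpoch_Suc by (simp only: mult_ac)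
  finally show ?case unfolding IH by (simp add: mult_ac)
qed simp

text \<open>The case \<open>a = q\<close> of the reversal with \<open>q^n\<close> cancelled. It
  turns \<open>(q^-N;q)_n\<close> into the quotient \<open>(q;q)_N / (q;q)_(N-n)\<close> up to sign
  and powers of \<open>q\<close>.\<close>

lemma qpoch_neg_power:
  assumes "y * complex_of_real q ^ N = 1" "n \<le> N" "q \<noteq> 0"
  shows "qpoch y q n * qpoch (complex_of_real q) q (N - n) * complex_of_real q ^ (N * n)
       = (\<Prod>j<n. - (complex_of_real q ^ j)) * qpoch (complex_of_real q) q N"
proof -
  have "y * complex_of_real q * complex_of_real q ^ N = complex_of_real q"
    using assms(1) by (simp add: mult_ac)
  from qpoch_reversal[OF this assms(2)] show ?thesis
    using assms(3) by (simp add: power_mult_distrib power_mult mult_ac)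
qed

section \<open>The q-Vandermonde and q-Pfaff-Saalschuetz summations\<close>

text \<open>The coefficient of \<open>z^n\<close> in the q-binomial series
  \<open>(az;q)_inf / (z;q)_inf\<close>. In this notation q-Vandermonde is a convolution.\<close>

definition qcoeff :: "complex \<Rightarrow> real \<Rightarrow> nat \<Rightarrow> complex" where
  "qcoeff a q n = qpoch a q n / qpoch (complex_of_real q) q n"

lemma qcoeff_Suc:
  assumes "0 < q" "q < 1"
  shows "(1 - complex_of_real q ^ Suc n) * qcoeff a q (Suc n)
       = qcoeff a q n * (1 - a * complex_of_real q ^ n)"
  using qpoch_base_nonzero[OF assms, of n] qpoch_base_nonzero[OF assms, of "Suc n"]
  by (simp add: qcoeff_def qpoch_Suc field_simps)

text \<open>Behind it stands
  \<open>(abz)_inf/(z)_inf = (abz)_inf/(bz)_inf * (bz)_inf/(z)_inf\<close>. The induction multiplies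
  by \<open>1 - q^(n+1) = (1 - q^(n+1-k)) + q^(n+1-k) (1 - q^k)\<close>, so that each part lowers
  the index of one of the two coefficients by \<open>qcoeff_Suc\<close>.\<close>

lemma q_Vandermonde:
  assumes q: "0 < q" "q < 1"
  shows "(\<Sum>k\<le>n. qcoeff a q k * qcoeff b q (n - k) * b ^ k) = qcoeff (a * b) q n"
proof (induction n)
  case (Suc n)
  let ?Q = "complex_of_real q"
  let ?T = "\<lambda>k. qcoeff a q k * qcoeff b q (Suc n - k) * b ^ k"
  have nz: "1 - ?Q ^ Suc n \<noteq> 0"
    using qpoch_base_nonzero[OF q, of "Suc n"] by (simp add: qpoch_Suc)
  \<comment> \<open>The summand \<open>k = n + 1\<close> vanishes because of its factor
    \<open>1 - q^0\<close>.\<close>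
  have left: "(\<Sum>k\<le>Suc n. (1 - ?Q ^ (Suc n - k)) * ?T k)
      = (\<Sum>k\<le>n. qcoeff a q k * qcoeff b q (n - k) * b ^ k * (1 - b * ?Q ^ (n - k)))"
  proof -
    have "(1 - ?Q ^ (Suc n - k)) * ?T k
        = qcoeff a q k * qcoeff b q (n - k) * b ^ k * (1 - b * ?Q ^ (n - k))" if "k \<le> n" for k
      using qcoeff_Suc[OF q, of "n - k" b] that by (simp add: Suc_diff_le mult_ac)
    then have "(\<Sum>k\<le>n. (1 - ?Q ^ (Suc n - k)) * ?T k)
        = (\<Sum>k\<le>n. qcoeff a q k * qcoeff b q (n - k) * b ^ k * (1 - b * ?Q ^ (n - k)))"
      by (intro sum.cong refl) (simp only: atMost_iff)
    then show ?thesis by simp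
  qed
  \<comment> \<open>Here the summand \<open>k = 0\<close> vanishes, and the rest is shifted by
    one.\<close>
  have right: "(\<Sum>k\<le>Suc n. ?Q ^ (Suc n - k) * (1 - ?Q ^ k) * ?T k)
      = (\<Sum>k\<le>n. qcoeff a q k * qcoeff b q (n - k) * b ^ k * (?Q ^ (n - k) * b * (1 - a * ?Q ^ k)))"
  proof -
    have "?Q ^ (Suc n - Suc k) * (1 - ?Q ^ Suc k) * ?T (Suc k)
        = qcoeff a q k * qcoeff b q (n - k) * b ^ k * (?Q ^ (n - k) * b * (1 - a * ?Q ^ k))" for k
      using qcoeff_Suc[OF q, of k a] by (simp add: mult_ac)
    then show ?thesis by (simp only: sum.atMost_Suc_shift) simp
  qed
  have "(1 - ?Q ^ Suc n) * (\<Sum>k\<le>Suc n. ?T k)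
      = (\<Sum>k\<le>Suc n. (1 - ?Q ^ (Suc n - k)) * ?T k + ?Q ^ (Suc n - k) * (1 - ?Q ^ k) * ?T k)"
    unfolding sum_distrib_left
  proof (rule sum.cong[OF refl])
    fix k assume "k \<in> {..Suc n}"
    then have "?Q ^ Suc n = ?Q ^ (Suc n - k) * ?Q ^ k"
      by (simp flip: power_add)
    then show "(1 - ?Q ^ Suc n) * ?T k
        = (1 - ?Q ^ (Suc n - k)) * ?T k + ?Q ^ (Suc n - k) * (1 - ?Q ^ k) * ?T k"
      by (simp only: algebra_simps mult_1_left mult_1_right)
  qed
  \<comment> \<open>The two halves recombine by
    \<open>(1 - b q^(n-k)) + b q^(n-k) (1 - a q^k) = 1 - a b q^n\<close>, which is free of
    \<open>k\<close>.\<close>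
  also have "\<dots> = (\<Sum>k\<le>n. qcoeff a q k * qcoeff b q (n - k) * b ^ k * (1 - a * b * ?Q ^ n))"
    unfolding sum.distrib left right unfolding sum.distrib[symmetric]
  proof (rule sum.cong[OF refl])
    fix k assume "k \<in> {..n}"
    then have "?Q ^ n = ?Q ^ (n - k) * ?Q ^ k"
      by (simp flip: power_add)
    then show "qcoeff a q k * qcoeff b q (n - k) * b ^ k * (1 - b * ?Q ^ (n - k))
        + qcoeff a q k * qcoeff b q (n - k) * b ^ k * (?Q ^ (n - k) * b * (1 - a * ?Q ^ k))
        = qcoeff a q k * qcoeff b q (n - k) * b ^ k * (1 - a * b * ?Q ^ n)"
      by (simp only: algebra_simps mult_1_left mult_1_right)
  qed
  also have "\<dots> = (1 - ?Q ^ Suc n) * qcoeff (a * b) q (Suc n)"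
    unfolding sum_distrib_right[symmetric] Suc.IH qcoeff_Suc[OF q] ..
  finally show ?case using nz by simp
qed (simp add: qcoeff_def)

lemma sum_triangle_swap:
  fixes f :: "nat \<Rightarrow> nat \<Rightarrow> 'a::comm_monoid_add"
  shows "(\<Sum>k\<le>N. \<Sum>n\<le>k. f k n) = (\<Sum>n\<le>N. \<Sum>k\<le>N - n. f (n + k) n)"
proof -
  have "(\<Sum>k\<le>N. \<Sum>n\<le>k. f k n) = (\<Sum>(k, n)\<in>(SIGMA k:{..N}. {..k}). f k n)"
    by (simp add: sum.Sigma)
  also have "\<dots> = (\<Sum>(n, k)\<in>(SIGMA n:{..N}. {..N - n}). f (n + k) n)"
    by (rule sum.reindex_bij_witness[where i = "\<lambda>(n, k). (n + k, n)" and j = "\<lambda>(k, n). (n, k - n)"])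
       auto
  finally show ?thesis by (simp add: sum.Sigma)
qed

text \<open>The q-Pfaff-Saalschuetz sum without denominator parameters. Expanding the last factor by
  q-Vandermonde and collecting the terms with the same \<open>(u;q)\<^sub>p\<close> leaves two further
  q-Vandermonde sums.\<close>
lemma q_Saalschuetz:
  assumes q: "0 < q" "q < 1"
  shows "(\<Sum>n\<le>N. qcoeff u q n * qpoch v q n * a ^ n * qpoch a q (N - n)
            * qcoeff (a * u * v * complex_of_real q ^ n) q (N - n))
       = qpoch (a * v) q N * qcoeff (a * u) q N"
proof -
  let ?Q = "complex_of_real q"
  let ?P = "\<lambda>n. qpoch ?Q q n"
  have nz: "?P n \<noteq> 0" for n using qpoch_base_nonzero[OF q] .
  \<comment> \<open>The summand after the expansion with Vandermonde parameters
    \<open>u * q^n\<close> and \<open>a * v\<close>, where \<open>p = n + k\<close> and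
    \<open>k\<close> is the new index. Everything before the parenthesis depends on \<open>p\<close>
    alone, and the parenthesis is a convolution in \<open>n\<close>.\<close>
  define F where "F p n = qpoch u q p * a ^ p * qcoeff (a * v) q (N - p) * qpoch a q (N - p)
      * (qcoeff v q n * qcoeff (a * ?Q ^ (N - p)) q (p - n) * v ^ (p - n))" for p n
  have "(\<Sum>n\<le>N. qcoeff u q n * qpoch v q n * a ^ n * qpoch a q (N - n)
            * qcoeff (a * u * v * ?Q ^ n) q (N - n))
      = (\<Sum>n\<le>N. \<Sum>k\<le>N - n. F (n + k) n)"
  proof (rule sum.cong[OF refl])
    fix n assume "n \<in> {..N}"
    then have n: "n \<le> N" by simp
    have "qcoeff (a * u * v * ?Q ^ n) q (N - n)
        = (\<Sum>k\<le>N - n. qcoeff (u * ?Q ^ n) q k * qcoeff (a * v) q (N - n - k) * (a * v) ^ k)"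
      by (subst q_Vandermonde[OF q]) (simp add: mult_ac)
    moreover have "qcoeff u q n * qpoch v q n * a ^ n * qpoch a q (N - n)
        * (qcoeff (u * ?Q ^ n) q k * qcoeff (a * v) q (N - n - k) * (a * v) ^ k) = F (n + k) n"
      if k: "k \<le> N - n" for k
    proof -
      have "N - (n + k) + k = N - n" using n k by simp
      then have s: "qpoch a q (N - n) = qpoch a q (N - (n + k)) * qpoch (a * ?Q ^ (N - (n + k))) q k"
        by (metis qpoch_add)
      show ?thesis
        unfolding F_def s qpoch_add[of u] using nz
        by (simp add: qcoeff_def power_mult_distrib power_add mult_ac)
    qed
    ultimately show "qcoeff u q n * qpoch v q n * a ^ n * qpoch a q (N - n)
        * qcoeff (a * u * v * ?Q ^ n) q (N - n) = (\<Sum>k\<le>N - n. F (n + k) n)"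
      by (simp add: sum_distrib_left)
  qed
  also have "\<dots> = (\<Sum>p\<le>N. \<Sum>n\<le>p. F p n)"
    by (rule sum_triangle_swap[symmetric])
  also have "\<dots> = (\<Sum>p\<le>N. qpoch (a * v) q N * (qcoeff u q p * qcoeff a q (N - p) * a ^ p))"
  proof (rule sum.cong[OF refl])
    fix p assume "p \<in> {..N}"
    then have p: "N = (N - p) + p" by simp
    \<comment> \<open>Reversing \<open>n\<close> attaches the power of \<open>v\<close> to the index
      of the first coefficient, as \<open>q_Vandermonde\<close> requires.\<close>
    have "(\<Sum>n\<le>p. qcoeff v q n * qcoeff (a * ?Q ^ (N - p)) q (p - n) * v ^ (p - n))
        = (\<Sum>n\<le>p. qcoeff (a * ?Q ^ (N - p)) q n * qcoeff v q (p - n) * v ^ n)"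
      by (rule sum.reindex_bij_witness[where i = "\<lambda>n. p - n" and j = "\<lambda>n. p - n"]) auto
    also have "\<dots> = qcoeff (a * v * ?Q ^ (N - p)) q p"
      unfolding q_Vandermonde[OF q] by (simp add: mult_ac)
    finally have "(\<Sum>n\<le>p. F p n) = qpoch u q p * a ^ p * qcoeff (a * v) q (N - p) * qpoch a q (N - p)
        * qcoeff (a * v * ?Q ^ (N - p)) q p"
      unfolding F_def by (simp flip: sum_distrib_left)
    moreover have "qpoch (a * v) q N = qpoch (a * v) q (N - p) * qpoch (a * v * ?Q ^ (N - p)) q p"
      by (subst p) (rule qpoch_add)
    ultimately show "(\<Sum>n\<le>p. F p n)
        = qpoch (a * v) q N * (qcoeff u q p * qcoeff a q (N - p) * a ^ p)"
      by (simp add: qcoeff_def mult_ac)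
  qed
  also have "\<dots> = qpoch (a * v) q N * qcoeff (a * u) q N"
    by (simp only: sum_distrib_left[symmetric] q_Vandermonde[OF q] mult.commute[of u])
  finally show ?thesis .
qed

text \<open>Exchanging the two summations, the sum over \<open>k\<close> is a q-Vandermonde sum and the remaining
  one is the Saalschuetz sum.\<close>
lemma sum_qcoeff_3phi2:
  assumes q: "0 < q" "q < 1"
    and b: "e * b = a * u * v"
    and x: "x * a * complex_of_real q ^ N = complex_of_real q"
    and y: "\<And>k. k \<le> N \<Longrightarrow> y k * complex_of_real q ^ k = 1"
    and z: "\<And>k. k \<le> N \<Longrightarrow> z k * b * complex_of_real q ^ N = complex_of_real q ^ Suc k"
    and e0: "qpoch e q N \<noteq> 0" and x0: "qpoch x q N \<noteq> 0"
  shows "(\<Sum>k\<le>N. qcoeff e q k * qcoeff b q (N - k) * b ^ k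
            * (\<Sum>n\<le>k. qpochs [v, u, y k] q n / qpochs [e, x, complex_of_real q] q n * z k ^ n))
          * qpoch a q N
       = qpoch (a * v) q N * qcoeff (a * u) q N"
proof -
  let ?Q = "complex_of_real q"
  let ?P = "\<lambda>n. qpoch ?Q q n"
  have nz: "?P n \<noteq> 0" for n using qpoch_base_nonzero[OF q] .
  have Q0: "?Q \<noteq> 0" using q by simp
  \<comment> \<open>The summand times \<open>(a;q)_N\<close> in cancelled form: reversing
    \<open>(x;q)_n\<close> and \<open>(y k;q)_n\<close> produces the same signed product
    \<open>K\<close>, and the relation for \<open>z k\<close> removes the remaining powers of
    \<open>q\<close>. Only the parenthesis depends on \<open>k\<close>.\<close>
  define F where "F k n = qcoeff u q n * qpoch v q n * a ^ n * qpoch a q (N - n)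
      * (qcoeff (e * ?Q ^ n) q (k - n) * qcoeff b q (N - k) * b ^ (k - n))" for k n
  have F: "qcoeff e q k * qcoeff b q (N - k) * b ^ k
        * (qpochs [v, u, y k] q n / qpochs [e, x, ?Q] q n * z k ^ n) * qpoch a q N = F k n"
    if k: "k \<le> N" and n: "n \<le> k" for k n
  proof -
    define K where "K = (\<Prod>j<n. - (?Q ^ j))"
    have K0: "K \<noteq> 0" using Q0 by (simp add: K_def)
    have xn: "qpoch x q n \<noteq> 0" using qpoch_nonzero_le[OF x0] k n by simp
    have en: "qpoch e q n \<noteq> 0" using qpoch_nonzero_le[OF e0] k n by simp
    have a: "qpoch x q n * qpoch a q (N - n) * (a * ?Q ^ N) ^ n = K * ?Q ^ n * qpoch a q N"
      unfolding K_def by (rule qpoch_reversal[OF x]) (use k n in simp)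
    have yk: "qpoch (y k) q n * ?P (k - n) * ?Q ^ (k * n) = K * ?P k"
      unfolding K_def by (rule qpoch_neg_power[OF y[OF k] n]) (use q in simp)
    have zk: "z k ^ n * b ^ n * ?Q ^ (N * n) = ?Q ^ n * ?Q ^ (k * n)"
      using arg_cong[OF z[OF k], of "\<lambda>w. w ^ n"] by (simp add: power_mult_distrib power_mult)
    have bk: "b ^ k = b ^ n * b ^ (k - n)"
      using n by (simp flip: power_add)
    have ea: "qpoch a q N = qpoch x q n * qpoch a q (N - n) * a ^ n * ?Q ^ (N * n) / (K * ?Q ^ n)"
      using a K0 Q0 by (simp add: field_simps power_mult_distrib power_mult)
    have ey: "qpoch (y k) q n = K * ?P k / (?P (k - n) * ?Q ^ (k * n))"
      using yk nz Q0 by (simp add: field_simps)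
    have "qcoeff e q k * qcoeff b q (N - k) * b ^ k
        * (qpochs [v, u, y k] q n / qpochs [e, x, ?Q] q n * z k ^ n) * qpoch a q N
        = F k n * (z k ^ n * b ^ n * ?Q ^ (N * n)) / (?Q ^ n * ?Q ^ (k * n))"
      unfolding F_def ea qpochs_def bk qcoeff_def qpoch_split[OF n, of e]
      using nz xn en K0 Q0 by (simp add: ey field_simps)
    also have "\<dots> = F k n" unfolding zk using Q0 by simp
    finally show ?thesis .
  qed
  have "(\<Sum>k\<le>N. qcoeff e q k * qcoeff b q (N - k) * b ^ k
            * (\<Sum>n\<le>k. qpochs [v, u, y k] q n / qpochs [e, x, ?Q] q n * z k ^ n)) * qpoch a q N
      = (\<Sum>k\<le>N. \<Sum>n\<le>k. F k n)"
    unfolding sum_distrib_left sum_distrib_right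
    by (intro sum.cong refl F) auto
  also have "\<dots> = (\<Sum>n\<le>N. \<Sum>k\<le>N - n. F (n + k) n)"
    by (rule sum_triangle_swap)
  also have "\<dots> = (\<Sum>n\<le>N. qcoeff u q n * qpoch v q n * a ^ n * qpoch a q (N - n)
            * qcoeff (a * u * v * ?Q ^ n) q (N - n))"
  proof (rule sum.cong[OF refl])
    fix n
    \<comment> \<open>The relation \<open>e * b = a * u * v\<close> makes the value of the inner
      Vandermonde sum the last factor in \<open>q_Saalschuetz\<close>.\<close>
    have eb: "e * ?Q ^ n * b = a * u * v * ?Q ^ n"
      using b by (simp add: mult_ac)
    show "(\<Sum>k\<le>N - n. F (n + k) n) = qcoeff u q n * qpoch v q n * a ^ n * qpoch a q (N - n)
            * qcoeff (a * u * v * ?Q ^ n) q (N - n)"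
      using q_Vandermonde[OF q, where a = "e * ?Q ^ n" and b = b and n = "N - n", unfolded eb]
      by (simp add: F_def flip: sum_distrib_left)
  qed
  also have "\<dots> = qpoch (a * v) q N * qcoeff (a * u) q N"
    by (rule q_Saalschuetz[OF q])
  finally show ?thesis .
qed


section \<open>Complex powers of \<open>q\<close> and the one-variable connection identities\<close>

lemma qpow_of_nat:
  assumes "0 < q"
  shows "qpow q (of_nat n) = complex_of_real q ^ n"
  using assms by (simp add: powr_nat')

lemma qpow_mult_power:
  assumes "0 < q"
  shows "qpow q a * complex_of_real q ^ n = qpow q (a + of_nat n)"
  by (simp only: powr_add qpow_of_nat[OF assms])

lemma qpow_of_nat_mult:
  assumes "0 < q"
  shows "qpow q (of_nat n * a) = qpow q a ^ n"
  by (induction n) (use assms in \<open>simp_all add: distrib_right powr_add\<close>)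

lemma qpow_neg_of_nat:
  assumes "0 < q"
  shows "qpow q (- of_nat n) * complex_of_real q ^ n = 1"
  using assms by (simp add: qpow_mult_power)

text \<open>The parameter \<open>a3 = q^-N\<close> kills every numerator beyond \<open>N\<close>, so
  those terms are zero whatever the denominator is.\<close>

lemma phi32_eq_sum:
  assumes "a3 * complex_of_real q ^ N = 1"
  shows "phi32 a1 a2 a3 b1 b2 q z
       = (\<Sum>n\<le>N. qpochs [a1, a2, a3] q n / qpochs [b1, b2, complex_of_real q] q n * z ^ n)"
  unfolding phi32_def
  by (rule suminf_finite) (auto simp: qpochs_def qpoch_terminates[OF assms])

text \<open>Terms with \<open>i < m\<close> vanish. With \<open>i = r - k\<close> and
  \<open>N = r - m\<close> the rest is \<open>sum_qcoeff_3phi2\<close> for the shifted parameters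
  \<open>a = q^(\<alpha>+m)\<close> and \<open>b = q^(\<mu>+m)\<close>. Then
  \<open>a * u = q^(\<gamma>+m)\<close> and \<open>a * v = q^(lam+m)\<close>, so the product side
  contains the tails of the factorials for \<gamma> and \<open>lam\<close>.\<close>

lemma sum_w12:
  assumes q: "0 < q" "q < 1" and m: "m \<le> r"
    and c0: "qpochs [qpow q \<gamma>, qpow q lam] q r \<noteq> 0"
    and \<mu>0: "qpoch (qpow q \<mu>) q m \<noteq> 0"
    and e0: "qpochs [qpow q (\<gamma> + lam - \<alpha> - \<mu>), qpow q (1 - of_nat r - \<alpha>)] q r \<noteq> 0"
  shows "(\<Sum>i\<le>r. w12 \<alpha> \<gamma> lam \<mu> i r q
            * (qpochs [qpow q lam, qpow q (- of_nat i)] q m / qpochs [qpow q \<mu>, \<delta>] q m))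
       = qpochs [qpow q \<alpha>, qpow q (- of_nat r)] q m / qpochs [qpow q \<gamma>, \<delta>] q m"
proof -
  let ?Q = "complex_of_real q"
  let ?P = "\<lambda>n. qpoch ?Q q n"
  let ?y = "\<lambda>n. qpow q (- of_nat n)"
  define A where "A = qpow q \<alpha>"
  define C where "C = qpow q \<gamma>"
  define L where "L = qpow q lam"
  define M where "M = qpow q \<mu>"
  define e where "e = qpow q (\<gamma> + lam - \<alpha> - \<mu>)"
  define x where "x = qpow q (1 - of_nat r - \<alpha>)"
  define u where "u = qpow q (\<gamma> - \<alpha>)"
  define v where "v = qpow q (lam - \<alpha>)"
  define N where "N = r - m"
  define a where "a = A * ?Q ^ m"
  define b where "b = M * ?Q ^ m"
  \<comment> \<open>\<open>z k\<close> and \<open>S k\<close> are the argument and the value of the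
    inner 3phi2 at \<open>i = r - k\<close>, where its third numerator parameter is
    \<open>q^-k\<close>.\<close>
  define z where "z k = qpow q (1 - of_nat (r - k) - \<mu>)" for k
  define K where "K = (\<Prod>j<m. - (?Q ^ j))"
  define S where "S k = (\<Sum>n\<le>k. qpochs [v, u, ?y k] q n / qpochs [e, x, ?Q] q n * z k ^ n)" for k
  have r: "r = m + N" using m by (simp add: N_def)
  have nz: "?P n \<noteq> 0" for n using qpoch_base_nonzero[OF q] .
  have Q0: "?Q \<noteq> 0" using q by simp
  have au: "a * u = C * ?Q ^ m"
    by (simp add: a_def A_def u_def C_def mult.commute mult.left_commute flip: powr_add)
  have av: "a * v = L * ?Q ^ m"
    by (simp add: a_def A_def v_def L_def mult.commute mult.left_commute flip: powr_add)
  have "M * e = A * u * v"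
    by (simp add: A_def u_def v_def M_def e_def algebra_simps flip: powr_add)
  then have eb: "e * b = a * u * v"
    by (simp add: b_def a_def mult_ac)
  have xA: "x * A * ?Q ^ r = ?Q"
    using Q0 by (simp add: x_def A_def qpow_mult_power[OF q(1)] flip: powr_add)
  have xa: "x * a * ?Q ^ N = ?Q"
    using xA by (simp add: a_def r power_add mult_ac)
  have zk: "z k * b * ?Q ^ N = ?Q ^ Suc k" if "k \<le> N" for k
  proof -
    have "r = (r - k) + k" using that r by simp
    then have "?Q ^ r = ?Q ^ (r - k) * ?Q ^ k" by (metis power_add)
    moreover have "z k * M * ?Q ^ (r - k) = ?Q"
      using Q0 by (simp add: z_def M_def qpow_mult_power[OF q(1)] flip: powr_add)
    moreover have "z k * b * ?Q ^ N = z k * M * ?Q ^ r"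
      by (simp add: b_def r power_add mult_ac)
    ultimately show ?thesis
      by (metis mult.assoc power_Suc)
  qed
  have y: "?y k * ?Q ^ k = 1" for k by (rule qpow_neg_of_nat[OF q(1)])
  have e0': "qpoch e q r \<noteq> 0" and x0': "qpoch x q r \<noteq> 0"
    using e0 by (auto simp: qpochs_def e_def x_def)
  have C0: "qpoch C q r \<noteq> 0" and L0: "qpoch L q r \<noteq> 0"
    using c0 by (auto simp: qpochs_def C_def L_def)
  have M0: "qpoch M q m \<noteq> 0" using \<mu>0 by (simp add: M_def)
  \<comment> \<open>The factorials of \<open>q^\<alpha>\<close> and of
    \<open>x = q^(1-r-\<alpha>)\<close> are reversals of each other, so the second being nonzero
    carries over to the first. This permits division by \<open>(a;q)_N\<close> below.\<close>
  have A0: "qpoch A q r \<noteq> 0"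
  proof -
    have "qpoch x q r * (A * ?Q ^ r) ^ r = (\<Prod>j<r. - (?Q ^ j)) * ?Q ^ r * qpoch A q r"
      using qpoch_reversal[OF xA order_refl] by simp
    moreover have "qpoch x q r * (A * ?Q ^ r) ^ r \<noteq> 0"
      using x0' Q0 by (simp add: A_def)
    ultimately show ?thesis by auto
  qed
  have split: "qpoch w q r = qpoch w q m * qpoch (w * ?Q ^ m) q N" for w
    unfolding r by (rule qpoch_add)
  have key: "(\<Sum>k\<le>N. qcoeff e q k * qcoeff b q (N - k) * b ^ k * S k) * qpoch a q N
      = qpoch (a * v) q N * qcoeff (a * u) q N"
    unfolding S_def
    by (rule sum_qcoeff_3phi2[OF q eb xa y zk])
       (use qpoch_nonzero_le[OF e0'] qpoch_nonzero_le[OF x0'] r in auto)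
  \<comment> \<open>All factors independent of \<open>k\<close>. The power \<open>q^(r*m)\<close>
    arises from \<open>q^((r-k)*m)\<close> when \<open>M^k\<close> is completed to
    \<open>b^k\<close>.\<close>
  define D where "D = qpoch A q r * ?P r * qpoch L q m * K
      / (qpoch C q r * qpoch L q r * ?Q ^ (r * m) * qpoch \<delta> q m)"
  let ?f = "\<lambda>i. w12 \<alpha> \<gamma> lam \<mu> i r q * (qpochs [L, ?y i] q m / qpochs [M, \<delta>] q m)"
  have term_eq: "?f (r - k) = D * (qcoeff e q k * qcoeff b q (N - k) * b ^ k * S k)"
    if k: "k \<le> N" for k
  proof -
    have kr: "k \<le> r" and mi: "m \<le> r - k" and rk: "r - (r - k) = k" and im: "r - k - m = N - k"
      using k r by auto
    have yk: "qpow q (of_nat (r - k) - of_nat r) = ?y k"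
      using kr by (simp add: of_nat_diff)
    have w: "w12 \<alpha> \<gamma> lam \<mu> (r - k) r q = qpoch A q r * ?P r / (qpoch C q r * qpoch L q r)
        * qcoeff e q k * (qpoch M q (r - k) / ?P (r - k)) * S k * M ^ k"
      unfolding w12_def rk yk phi32_eq_sum[OF y] qpow_of_nat_mult[OF q(1)]
      by (simp add: qpochs_def S_def qcoeff_def z_def A_def C_def L_def M_def e_def x_def u_def v_def)
    have Mi: "qpoch M q (r - k) = qpoch M q m * qpoch b q (N - k)"
      unfolding b_def using qpoch_split[OF mi, of M q] by (simp only: im)
    have "qpoch (?y (r - k)) q m * ?P (N - k) * ?Q ^ ((r - k) * m) = K * ?P (r - k)"
      unfolding K_def using qpoch_neg_power[OF y mi] q by (simp only: im)
    then have yi: "qpoch (?y (r - k)) q m = K * ?P (r - k) / (?P (N - k) * ?Q ^ ((r - k) * m))"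
      using nz Q0 by (simp add: field_simps)
    have "r * m = (r - k) * m + k * m"
      using kr by (simp flip: add_mult_distrib)
    then have Qr: "?Q ^ (r * m) = ?Q ^ ((r - k) * m) * ?Q ^ (k * m)"
      by (simp add: power_add)
    have bk: "b ^ k = M ^ k * ?Q ^ (k * m)"
      by (simp add: b_def power_mult_distrib mult.commute flip: power_mult)
    show ?thesis
      unfolding w D_def Qr bk qpochs_def
      using nz Q0 M0 by (simp add: Mi yi qcoeff_def mult_ac)
  qed
  \<comment> \<open>For \<open>i < m\<close> the factor \<open>(q^-i;q)_m\<close> is zero.\<close>
  have "(\<Sum>i\<le>r. ?f i) = (\<Sum>i\<in>{m..r}. ?f i)"
    by (rule sum.mono_neutral_right) (auto simp: qpochs_def qpoch_terminates[OF y])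
  also have "\<dots> = (\<Sum>k\<le>N. ?f (r - k))"
    by (rule sum.reindex_bij_witness[where i = "\<lambda>k. r - k" and j = "\<lambda>i. r - i"]) (use r in auto)
  also have "\<dots> = D * (\<Sum>k\<le>N. qcoeff e q k * qcoeff b q (N - k) * b ^ k * S k)"
    unfolding sum_distrib_left by (intro sum.cong refl term_eq) simp
  also have "\<dots> = D * (qpoch (L * ?Q ^ m) q N * qcoeff (C * ?Q ^ m) q N / qpoch a q N)"
    using key[unfolded au av] A0[unfolded split, folded a_def] by (simp add: field_simps)
  also have "\<dots> = qpoch A q m * (K * ?P r / (?P N * ?Q ^ (r * m))) / (qpoch C q m * qpoch \<delta> q m)"
    using A0 C0 L0 nz unfolding D_def split[of A] split[of C] split[of L] qcoeff_def a_def
    by (simp add: field_simps)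
  \<comment> \<open>The reversal read backwards, now for \<open>q^-r\<close>.\<close>
  also have "K * ?P r / (?P N * ?Q ^ (r * m)) = qpoch (?y r) q m"
    using qpoch_neg_power[OF y m] q nz Q0 by (simp add: K_def N_def field_simps)
  finally show ?thesis
    by (simp add: qpochs_def A_def C_def L_def M_def)
qed

text \<open>The same reduction as in \<open>sum_w12\<close>, but without an inner series: after
  \<open>k\<close> is replaced by \<open>t - k\<close> a single q-Vandermonde sum remains, whose
  parameters multiply to \<open>q^(\<gamma>+p)\<close>.\<close>

lemma sum_w3:
  assumes q: "0 < q" "q < 1" and m: "p \<le> t"
    and c0: "qpoch (qpow q \<gamma>) q t \<noteq> 0"
    and \<mu>0: "qpoch (qpow q \<mu>) q p \<noteq> 0"
  shows "(\<Sum>k\<le>t. w3 \<gamma> \<mu> k t q * (qpochs [qpow q (- of_nat k)] q p / qpochs [qpow q \<mu>, \<delta>] q p))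
       = qpochs [qpow q (- of_nat t)] q p / qpochs [qpow q \<gamma>, \<delta>] q p"
proof -
  let ?Q = "complex_of_real q"
  let ?P = "\<lambda>n. qpoch ?Q q n"
  let ?y = "\<lambda>n. qpow q (- of_nat n)"
  define C where "C = qpow q \<gamma>"
  define M where "M = qpow q \<mu>"
  define e where "e = qpow q (\<gamma> - \<mu>)"
  define N where "N = t - p"
  define b where "b = M * ?Q ^ p"
  define K where "K = (\<Prod>j<p. - (?Q ^ j))"
  have t: "t = p + N" using m by (simp add: N_def)
  have nz: "?P n \<noteq> 0" for n using qpoch_base_nonzero[OF q] .
  have Q0: "?Q \<noteq> 0" using q by simp
  have "e * M = C"
    by (simp add: M_def e_def C_def flip: powr_add)
  then have eb: "e * b = C * ?Q ^ p"
    by (simp add: b_def mult_ac)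
  have y: "?y k * ?Q ^ k = 1" for k by (rule qpow_neg_of_nat[OF q(1)])
  have C0: "qpoch C q t \<noteq> 0" using c0 by (simp add: C_def)
  have M0: "qpoch M q p \<noteq> 0" using \<mu>0 by (simp add: M_def)
  have split: "qpoch w q t = qpoch w q p * qpoch (w * ?Q ^ p) q N" for w
    unfolding t by (rule qpoch_add)
  define D where "D = ?P t * K / (qpoch C q t * ?Q ^ (t * p) * qpoch \<delta> q p)"
  let ?f = "\<lambda>i. w3 \<gamma> \<mu> i t q * (qpochs [?y i] q p / qpochs [M, \<delta>] q p)"
  have term_eq: "?f (t - k) = D * (qcoeff e q k * qcoeff b q (N - k) * b ^ k)"
    if k: "k \<le> N" for k
  proof -
    have kt: "k \<le> t" and mi: "p \<le> t - k" and tk: "t - (t - k) = k" and im: "t - k - p = N - k"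
      using k t by auto
    have w: "w3 \<gamma> \<mu> (t - k) t q = ?P t / qpoch C q t
        * qcoeff e q k * (qpoch M q (t - k) / ?P (t - k)) * M ^ k"
      unfolding w3_def tk qpow_of_nat_mult[OF q(1)]
      by (simp add: qcoeff_def C_def M_def e_def)
    have Mi: "qpoch M q (t - k) = qpoch M q p * qpoch b q (N - k)"
      unfolding b_def using qpoch_split[OF mi, of M q] by (simp only: im)
    have "qpoch (?y (t - k)) q p * ?P (N - k) * ?Q ^ ((t - k) * p) = K * ?P (t - k)"
      unfolding K_def using qpoch_neg_power[OF y mi] q by (simp only: im)
    then have yi: "qpoch (?y (t - k)) q p = K * ?P (t - k) / (?P (N - k) * ?Q ^ ((t - k) * p))"
      using nz Q0 by (simp add: field_simps)
    have "t * p = (t - k) * p + k * p"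
      using kt by (simp flip: add_mult_distrib)
    then have Qt: "?Q ^ (t * p) = ?Q ^ ((t - k) * p) * ?Q ^ (k * p)"
      by (simp add: power_add)
    have bk: "b ^ k = M ^ k * ?Q ^ (k * p)"
      by (simp add: b_def power_mult_distrib mult.commute flip: power_mult)
    show ?thesis
      unfolding w D_def Qt bk qpochs_def
      using nz Q0 M0 by (simp add: Mi yi qcoeff_def mult_ac)
  qed
  have "(\<Sum>i\<le>t. ?f i) = (\<Sum>i\<in>{p..t}. ?f i)"
    by (rule sum.mono_neutral_right) (auto simp: qpochs_def qpoch_terminates[OF y])
  also have "\<dots> = (\<Sum>k\<le>N. ?f (t - k))"
    by (rule sum.reindex_bij_witness[where i = "\<lambda>k. t - k" and j = "\<lambda>i. t - i"]) (use t in auto)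
  also have "\<dots> = D * (\<Sum>k\<le>N. qcoeff e q k * qcoeff b q (N - k) * b ^ k)"
    unfolding sum_distrib_left by (intro sum.cong refl term_eq) simp
  also have "\<dots> = D * qcoeff (C * ?Q ^ p) q N"
    unfolding q_Vandermonde[OF q] eb ..
  also have "\<dots> = (K * ?P t / (?P N * ?Q ^ (t * p))) / (qpoch C q p * qpoch \<delta> q p)"
    using C0 nz unfolding D_def split[of C] qcoeff_def
    by (simp add: field_simps)
  also have "K * ?P t / (?P N * ?Q ^ (t * p)) = qpoch (?y t) q p"
    using qpoch_neg_power[OF y m] q nz Q0 by (simp add: K_def N_def field_simps)
  finally show ?thesis
    by (simp add: qpochs_def C_def M_def)
qed

section \<open>The terminating triple series and the exchange of sums\<close>

text \<open>The box may exceed the range where the terms are nonzero. Hence the series for all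
  \<open>i\<close>, \<open>j\<close>, \<open>k\<close> can be written over one fixed box, which is
  what makes the sums exchangeable.\<close>

lemma phi3_eq_sum:
  assumes y: "y1 * complex_of_real q ^ i = 1" "y2 * complex_of_real q ^ j = 1"
      "y3 * complex_of_real q ^ k = 1"
    and le: "i \<le> r" "j \<le> s" "k \<le> t"
  shows "phi3 b' b'' [c1, y1] [c2, y2] [y3] h h' h'' q X Y Z
       = (\<Sum>m\<le>r. \<Sum>n\<le>s. \<Sum>p\<le>t.
           qpochs b' q (n + p) * qpochs b'' q (p + m)
           * (qpochs [c1, y1] q m / qpochs h q m)
           * (qpochs [c2, y2] q n / qpochs h' q n)
           * (qpochs [y3] q p / qpochs h'' q p)
           * (X ^ m / qpoch (complex_of_real q) q m)
           * (Y ^ n / qpoch (complex_of_real q) q n)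
           * (Z ^ p / qpoch (complex_of_real q) q p))"
proof -
  let ?g = "\<lambda>(m, n, p). qpochs b' q (n + p) * qpochs b'' q (p + m)
           * (qpochs [c1, y1] q m / qpochs h q m)
           * (qpochs [c2, y2] q n / qpochs h' q n)
           * (qpochs [y3] q p / qpochs h'' q p)
           * (X ^ m / qpoch (complex_of_real q) q m)
           * (Y ^ n / qpoch (complex_of_real q) q n)
           * (Z ^ p / qpoch (complex_of_real q) q p)"
  have "qpoch y1 q m = 0 \<or> qpoch y2 q n = 0 \<or> qpoch y3 q p = 0"
    if "(m, n, p) \<notin> {..r} \<times> {..s} \<times> {..t}" for m n p
    using that le qpoch_terminates[OF y(1), of m] qpoch_terminates[OF y(2), of n]
      qpoch_terminates[OF y(3), of p] by force
  then have zero: "?g w = 0" if "w \<notin> {..r} \<times> {..s} \<times> {..t}" for w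
    using that by (cases w) (fastforce simp: qpochs_def)
  have "phi3 b' b'' [c1, y1] [c2, y2] [y3] h h' h'' q X Y Z
      = infsum ?g ({..r} \<times> {..s} \<times> {..t})"
    unfolding phi3_def by (rule infsum_cong_neutral) (use zero in auto)
  also have "\<dots> = sum ?g ({..r} \<times> {..s} \<times> {..t})"
    by simp
  finally show ?thesis
    by (simp add: sum.cartesian_product)
qed

theorem theorem4p7:
  fixes q :: real and r s t :: nat
    and \<alpha>1 \<alpha>2 \<beta>1 \<beta>2 \<gamma>1 \<gamma>2 \<gamma>3 lam1 lam2 \<mu>1 \<mu>2 \<mu>3 \<delta>1 \<delta>2 \<delta>3 :: complex
  assumes q: "0 < q" "q < 1"
    and den_lhs_1: "\<And>m. m \<le> r \<Longrightarrow> qpochs [qpow q \<gamma>1, \<delta>1] q m \<noteq> 0"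
    and den_lhs_2: "\<And>n. n \<le> s \<Longrightarrow> qpochs [qpow q \<gamma>2, \<delta>2] q n \<noteq> 0"
    and den_lhs_3: "\<And>p. p \<le> t \<Longrightarrow> qpochs [qpow q \<gamma>3, \<delta>3] q p \<noteq> 0"
    and den_rhs_1: "\<And>m. m \<le> r \<Longrightarrow> qpochs [qpow q \<mu>1, \<delta>1] q m \<noteq> 0"
    and den_rhs_2: "\<And>n. n \<le> s \<Longrightarrow> qpochs [qpow q \<mu>2, \<delta>2] q n \<noteq> 0"
    and den_rhs_3: "\<And>p. p \<le> t \<Longrightarrow> qpochs [qpow q \<mu>3, \<delta>3] q p \<noteq> 0"
    and den_w1: "qpochs [qpow q \<gamma>1, qpow q lam1] q r \<noteq> 0"
    and den_w2: "qpochs [qpow q \<gamma>2, qpow q lam2] q s \<noteq> 0"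
    and den_w3: "qpoch (qpow q \<gamma>3) q t \<noteq> 0"
    and den_phi32_1: "\<And>i n. i \<le> r \<Longrightarrow> n \<le> r - i \<Longrightarrow>
      qpochs [qpow q (\<gamma>1 + lam1 - \<alpha>1 - \<mu>1), qpow q (1 - of_nat r - \<alpha>1)] q n \<noteq> 0"
    and den_phi32_2: "\<And>j n. j \<le> s \<Longrightarrow> n \<le> s - j \<Longrightarrow>
      qpochs [qpow q (\<gamma>2 + lam2 - \<beta>2 - \<mu>2), qpow q (1 - of_nat s - \<beta>2)] q n \<noteq> 0"
  shows "phi3 [qpow q \<alpha>2] [qpow q \<beta>1]
           [qpow q \<alpha>1, qpow q (- of_nat r)] [qpow q \<beta>2, qpow q (- of_nat s)] [qpow q (- of_nat t)]
           [qpow q \<gamma>1, \<delta>1] [qpow q \<gamma>2, \<delta>2] [qpow q \<gamma>3, \<delta>3]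
           q (complex_of_real q) (complex_of_real q) (complex_of_real q)
       = (\<Sum>i=0..r. \<Sum>j=0..s. \<Sum>k=0..t.
           w12 \<alpha>1 \<gamma>1 lam1 \<mu>1 i r q * w12 \<beta>2 \<gamma>2 lam2 \<mu>2 j s q * w3 \<gamma>3 \<mu>3 k t q *
           phi3 [qpow q \<alpha>2] [qpow q \<beta>1]
             [qpow q lam1, qpow q (- of_nat i)] [qpow q lam2, qpow q (- of_nat j)] [qpow q (- of_nat k)]
             [qpow q \<mu>1, \<delta>1] [qpow q \<mu>2, \<delta>2] [qpow q \<mu>3, \<delta>3]
             q (complex_of_real q) (complex_of_real q) (complex_of_real q))"
proof -
  let ?Q = "complex_of_real q"
  let ?y = "\<lambda>n. qpow q (- of_nat n)"
  \<comment> \<open>\<open>G\<close> gathers the factors common to both sides, including the two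
    that couple the indices; \<open>F1\<close>, \<open>F2\<close>, \<open>F3\<close> each involve
    one index only.\<close>
  define G where "G m n p = qpochs [qpow q \<alpha>2] q (n + p) * qpochs [qpow q \<beta>1] q (p + m)
      * (?Q ^ m / qpoch ?Q q m) * (?Q ^ n / qpoch ?Q q n) * (?Q ^ p / qpoch ?Q q p)" for m n p
  define F1 where "F1 i m = qpochs [qpow q lam1, ?y i] q m / qpochs [qpow q \<mu>1, \<delta>1] q m" for i m
  define F2 where "F2 j n = qpochs [qpow q lam2, ?y j] q n / qpochs [qpow q \<mu>2, \<delta>2] q n" for j n
  define F3 where "F3 k p = qpochs [?y k] q p / qpochs [qpow q \<mu>3, \<delta>3] q p" for k p
  define W1 where "W1 i = w12 \<alpha>1 \<gamma>1 lam1 \<mu>1 i r q" for i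
  define W2 where "W2 j = w12 \<beta>2 \<gamma>2 lam2 \<mu>2 j s q" for j
  define W3 where "W3 k = w3 \<gamma>3 \<mu>3 k t q" for k
  have y: "?y k * ?Q ^ k = 1" for k by (rule qpow_neg_of_nat[OF q(1)])
  \<comment> \<open>The inner 3phi2 with \<open>i = 0\<close> has the longest range,
    \<open>n \<le> r\<close>; its last denominator covers those for every \<open>i\<close>.\<close>
  have S1: "qpochs [qpow q \<alpha>1, ?y r] q m / qpochs [qpow q \<gamma>1, \<delta>1] q m = (\<Sum>i\<le>r. W1 i * F1 i m)"
    if "m \<le> r" for m
    unfolding W1_def F1_def
    by (rule sum_w12[OF q that den_w1, symmetric])
       (use den_rhs_1[OF that] den_phi32_1[of 0 r] in \<open>auto simp: qpochs_def\<close>)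
  have S2: "qpochs [qpow q \<beta>2, ?y s] q n / qpochs [qpow q \<gamma>2, \<delta>2] q n = (\<Sum>j\<le>s. W2 j * F2 j n)"
    if "n \<le> s" for n
    unfolding W2_def F2_def
    by (rule sum_w12[OF q that den_w2, symmetric])
       (use den_rhs_2[OF that] den_phi32_2[of 0 s] in \<open>auto simp: qpochs_def\<close>)
  have S3: "qpochs [?y t] q p / qpochs [qpow q \<gamma>3, \<delta>3] q p = (\<Sum>k\<le>t. W3 k * F3 k p)"
    if "p \<le> t" for p
    unfolding W3_def F3_def
    by (rule sum_w3[OF q that den_w3, symmetric])
       (use den_rhs_3[OF that] in \<open>auto simp: qpochs_def\<close>)
  have rhs: "phi3 [qpow q \<alpha>2] [qpow q \<beta>1]
             [qpow q lam1, ?y i] [qpow q lam2, ?y j] [?y k]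
             [qpow q \<mu>1, \<delta>1] [qpow q \<mu>2, \<delta>2] [qpow q \<mu>3, \<delta>3] q ?Q ?Q ?Q
      = (\<Sum>m\<le>r. \<Sum>n\<le>s. \<Sum>p\<le>t. G m n p * F1 i m * F2 j n * F3 k p)"
    if "i \<le> r" "j \<le> s" "k \<le> t" for i j k
    unfolding phi3_eq_sum[OF y y y that] G_def F1_def F2_def F3_def
    by (intro sum.cong refl) (simp only: mult_ac)
  have "phi3 [qpow q \<alpha>2] [qpow q \<beta>1]
           [qpow q \<alpha>1, ?y r] [qpow q \<beta>2, ?y s] [?y t]
           [qpow q \<gamma>1, \<delta>1] [qpow q \<gamma>2, \<delta>2] [qpow q \<gamma>3, \<delta>3] q ?Q ?Q ?Q
      = (\<Sum>m\<le>r. \<Sum>n\<le>s. \<Sum>p\<le>t. G m n p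
          * (qpochs [qpow q \<alpha>1, ?y r] q m / qpochs [qpow q \<gamma>1, \<delta>1] q m)
          * (qpochs [qpow q \<beta>2, ?y s] q n / qpochs [qpow q \<gamma>2, \<delta>2] q n)
          * (qpochs [?y t] q p / qpochs [qpow q \<gamma>3, \<delta>3] q p))"
    unfolding phi3_eq_sum[OF y y y order_refl order_refl order_refl] G_def
    by (intro sum.cong refl) (simp only: mult_ac)
  also have "\<dots> = (\<Sum>m\<le>r. \<Sum>n\<le>s. \<Sum>p\<le>t. G m n p
      * (\<Sum>i\<le>r. W1 i * F1 i m) * (\<Sum>j\<le>s. W2 j * F2 j n) * (\<Sum>k\<le>t. W3 k * F3 k p))"
    by (intro sum.cong refl) (simp only: S1 S2 S3 atMost_iff)
  \<comment> \<open>Written over product sets, the six-fold sum needs only one application of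
    \<open>sum.swap\<close> between the series indices and the connection indices.\<close>
  also have "\<dots> = (\<Sum>(m, n, p)\<in>{..r} \<times> {..s} \<times> {..t}. \<Sum>(i, j, k)\<in>{..r} \<times> {..s} \<times> {..t}.
      W1 i * W2 j * W3 k * (G m n p * F1 i m * F2 j n * F3 k p))"
    by (simp add: sum_distrib_left sum_distrib_right mult_ac flip: sum.cartesian_product)
  also have "\<dots> = (\<Sum>(i, j, k)\<in>{..r} \<times> {..s} \<times> {..t}. \<Sum>(m, n, p)\<in>{..r} \<times> {..s} \<times> {..t}.
      W1 i * W2 j * W3 k * (G m n p * F1 i m * F2 j n * F3 k p))"
    unfolding case_prod_unfold by (rule sum.swap)
  also have "\<dots> = (\<Sum>i\<le>r. \<Sum>j\<le>s. \<Sum>k\<le>t. W1 i * W2 j * W3 k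
      * (\<Sum>m\<le>r. \<Sum>n\<le>s. \<Sum>p\<le>t. G m n p * F1 i m * F2 j n * F3 k p))"
    by (simp add: sum_distrib_left flip: sum.cartesian_product)
  finally show ?thesis
    by (simp add: rhs W1_def W2_def W3_def atMost_atLeast0[symmetric])
qed

end
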